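(* For all $n\geq1$, $c_n(1\text{-}12)=c_n(1\text{-}21)=c_n(1\text{-}23)=2^{n-1}$, $c_n(2\text{-}12)=F_{2n-1}$ and $c_n(3\text{-}12)=\frac{3^{n-1}+1}{2}$.
   Context: A Catalan word of length $n\ge 1$ is a sequence $\pi=\pi_1\cdots\pi_n$ of positive integers with $\pi_1=1$ and $\pi_{i+1}\le \pi_i+1$ for $1\le i\le n-1$; $\mathcal{C}_n$ is the set of these. Two sequences of the same length are order-isomorphic if their corresponding pairs of entries stand in the same relation ($<$, $>$ or $=$). A word $\pi$ contains the vincular pattern $x\text{-}yz$ if there are indices $i<j$ with $j+1\le n$ such that $\pi_i\pi_j\pi_{j+1}$ is order-isomorphic to $xyz$ (the last two letters must be adjacent in $\pi$); otherwise $\pi$ avoids it. $c_n(\tau)$ denotes the number of members of $\mathcal{C}_n$ avoiding $\tau$. $F_n$ is the Fibonacci sequence: $F_0=0$, $F_1=1$, $F_n=F_{n-1}+F_{n-2}$ for $n\ge 2$. *)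

theory Defs
  imports "HOL-Number_Theory.Fib"
begin

text \<open>Words are lists of natural numbers; the paper's letter $\pi_i$ is the list entry
  \<open>w ! (i - 1)\<close>.\<close>

definition catalan_word :: "nat list \<Rightarrow> bool" where
  "catalan_word w \<longleftrightarrow>
     w \<noteq> [] \<and> (\<forall>x \<in> set w. 1 \<le> x) \<and> hd w = 1 \<and>
     (\<forall>i. Suc i < length w \<longrightarrow> w ! Suc i \<le> w ! i + 1)"

definition catalan_words :: "nat \<Rightarrow> nat list set" where
  "catalan_words n = {w. catalan_word w \<and> length w = n}"

text \<open>The relation \<open>>\<close> is covered by \<open><\<close> with the two positions exchanged.\<close>

definition order_isomorphic :: "nat list \<Rightarrow> nat list \<Rightarrow> bool" where
  "order_isomorphic u v \<longleftrightarrow>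
     length u = length v \<and>
     (\<forall>i < length u. \<forall>j < length u.
        (u ! i < u ! j \<longleftrightarrow> v ! i < v ! j) \<and> (u ! i = u ! j \<longleftrightarrow> v ! i = v ! j))"

text \<open>The vincular pattern $x\text{-}yz$ is given by its three letters.\<close>

definition contains_vincular :: "nat list \<Rightarrow> nat \<Rightarrow> nat \<Rightarrow> nat \<Rightarrow> bool" where
  "contains_vincular w x y z \<longleftrightarrow>
     (\<exists>i j. i < j \<and> Suc j < length w \<and> order_isomorphic [w ! i, w ! j, w ! Suc j] [x, y, z])"

definition catalan_avoiding_count :: "nat \<Rightarrow> nat \<Rightarrow> nat \<Rightarrow> nat \<Rightarrow> nat" where
  "catalan_avoiding_count n x y z = card {w \<in> catalan_words n. \<not> contains_vincular w x y z}"

end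

theory Submission
  imports Defs
begin

text \<open>
  The words are counted letter by letter from the left. Whether a letter may be appended to an
  avoiding Catalan word \<open>p\<close> depends only on \<open>last p\<close> and on which letters occur earlier
  (\<open>avoiders_snoc\<close>), and the letters of a Catalan word form an interval \<open>{1..m}\<close>. Hence the number
  of completions of \<open>p\<close> to an avoider by \<open>k\<close> more letters is a function of \<open>k\<close> and of a small state
  of \<open>p\<close>, and \<open>card_completions_Suc\<close> turns the list of permitted letters into a recurrence.

  \<^item> Avoiding 1-21 means being weakly increasing, because the lower letter of a descent has always
    occurred before; avoiding 1-23 means using only the letters 1 and 2, because the initial 1
    forbids ascents from larger letters. Either way two letters are permitted at each step.

  \<^item> For 1-12, 2-12 and 3-12 an ascent is permitted only from a letter that is new, maximal, or at
    most one below the maximum, respectively. Once the last letter fails this condition, so do all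
    later ones, and the word is weakly decreasing from then on; such continuations are counted by
    \<open>decreasing_count\<close>.

  The resulting recurrences involve the unbounded parameter \<open>m\<close>. They are solved by the Pascal rule
  \<open>f (i + 1) (k + 1) = f (i + 1) k + f i (k + 1)\<close>, which all the counting functions satisfy. Its
  combinatorial reason is that, once the letter 1 is far enough below the maximum, it can be followed
  only by further 1s: a continuation either ends in 1, which may be deleted, or has no 1 at all, and
  then all letters may be lowered by one. The rule expresses the values at parameter \<open>i + 1\<close> through
  those at parameter \<open>i\<close>, so that the recurrence at the smallest parameter closes up and yields
  powers of 2, Fibonacci numbers of consecutive indices, and powers of 3.
\<close>

section \<open>Catalan words and avoidance under appending a letter\<close>

definition avoiders :: "nat \<Rightarrow> nat \<Rightarrow> nat \<Rightarrow> nat list set" where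
  "avoiders x y z = {w. catalan_word w \<and> \<not> contains_vincular w x y z}"

lemma catalan_word_snoc:
  assumes "p \<noteq> []"
  shows "catalan_word (p @ [a]) \<longleftrightarrow> catalan_word p \<and> 1 \<le> a \<and> a \<le> Suc (last p)"
proof -
  have "(\<forall>i. Suc i < length (p @ [a]) \<longrightarrow> (p @ [a]) ! Suc i \<le> (p @ [a]) ! i + 1) \<longleftrightarrow>
        (\<forall>i. Suc i < length p \<longrightarrow> p ! Suc i \<le> p ! i + 1) \<and> a \<le> Suc (last p)" (is "?L \<longleftrightarrow> ?R")
  proof
    assume L: ?L
    show ?R
    proof (intro conjI allI impI)
      fix i assume "Suc i < length p"
      then show "p ! Suc i \<le> p ! i + 1" using L[rule_format, of i] by (simp add: nth_append)
    next
      show "a \<le> Suc (last p)"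
        using L[rule_format, of "length p - 1"] assms by (simp add: nth_append last_conv_nth)
    qed
  next
    assume R: ?R
    show ?L
    proof (intro allI impI)
      fix i assume i: "Suc i < length (p @ [a])"
      show "(p @ [a]) ! Suc i \<le> (p @ [a]) ! i + 1"
      proof (cases "Suc i = length p")
        case True
        then have "i = length p - 1" by simp
        then show ?thesis using True R assms by (simp add: nth_append last_conv_nth)
      next
        case False
        then show ?thesis using i R by (simp add: nth_append)
      qed
    qed
  qed
  then show ?thesis using assms by (auto simp: catalan_word_def)
qed

lemma contains_vincular_snoc:
  assumes "p \<noteq> []"
  shows "contains_vincular (p @ [a]) x y z \<longleftrightarrow>
    contains_vincular p x y z \<or> (\<exists>b \<in> set (butlast p). order_isomorphic [b, last p, a] [x, y, z])"
    (is "?L \<longleftrightarrow> ?R")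
proof
  assume ?L
  then obtain i j where ij: "i < j" "Suc j < length (p @ [a])"
    and iso: "order_isomorphic [(p @ [a]) ! i, (p @ [a]) ! j, (p @ [a]) ! Suc j] [x, y, z]"
    unfolding contains_vincular_def by blast
  show ?R
  proof (cases "Suc j = length p")
    case True
    then have j: "j = length p - 1" by simp
    have "i < length (butlast p)" using ij j by simp
    then have "p ! i \<in> set (butlast p)"
      by (metis nth_butlast nth_mem)
    moreover have "order_isomorphic [p ! i, last p, a] [x, y, z]"
      using iso ij True j assms by (simp add: nth_append last_conv_nth)
    ultimately show ?thesis by metis
  next
    case False
    then have "Suc j < length p" using ij by simp
    then show ?thesis using ij(1) iso by (auto simp: nth_append contains_vincular_def)
  qed
next
  assume ?R
  then show ?L
  proof
    assume "contains_vincular p x y z"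
    then obtain i j where "i < j" "Suc j < length p"
      "order_isomorphic [p ! i, p ! j, p ! Suc j] [x, y, z]"
      unfolding contains_vincular_def by blast
    then show ?L
      unfolding contains_vincular_def
      by (intro exI[of _ i] exI[of _ j]) (simp add: nth_append)
  next
    assume "\<exists>b \<in> set (butlast p). order_isomorphic [b, last p, a] [x, y, z]"
    then obtain i where i: "i < length (butlast p)"
      and iso: "order_isomorphic [butlast p ! i, last p, a] [x, y, z]"
      by (metis in_set_conv_nth)
    obtain j where j: "length p = Suc j" using assms by (cases p) auto
    then have "last p = p ! j" using assms by (simp add: last_conv_nth)
    then show ?L
      unfolding contains_vincular_def using i iso j
      by (intro exI[of _ i] exI[of _ j]) (simp add: nth_append nth_butlast)
  qed
qed

lemma avoiders_snoc:
  assumes "p \<noteq> []"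
  shows "p @ [a] \<in> avoiders x y z \<longleftrightarrow>
    p \<in> avoiders x y z \<and> a \<in> {1..Suc (last p)} \<and>
    (\<forall>b \<in> set (butlast p). \<not> order_isomorphic [b, last p, a] [x, y, z])"
  using assms by (auto simp: avoiders_def catalan_word_snoc contains_vincular_snoc)

lemma order_isomorphic_patterns:
  "order_isomorphic [b, l, a] [1, 1, 2] \<longleftrightarrow> b = l \<and> l < a"
  "order_isomorphic [b, l, a] [1, 2, 1] \<longleftrightarrow> b = a \<and> a < l"
  "order_isomorphic [b, l, a] [1, 2, 3] \<longleftrightarrow> b < l \<and> l < a"
  "order_isomorphic [b, l, a] [2, 1, 2] \<longleftrightarrow> b = a \<and> l < a"
  "order_isomorphic [b, l, a] [3, 1, 2] \<longleftrightarrow> l < a \<and> a < b"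
  by (auto simp: order_isomorphic_def All_less_Suc)

lemma singleton_in_avoiders: "[1] \<in> avoiders x y z"
  by (simp add: avoiders_def catalan_word_def contains_vincular_def)

lemma avoiders_nonempty: "p \<in> avoiders x y z \<Longrightarrow> p \<noteq> []"
  by (auto simp: avoiders_def catalan_word_def)

lemma in_set_butlast_iff: "p \<noteq> [] \<Longrightarrow> b \<noteq> last p \<Longrightarrow> b \<in> set (butlast p) \<longleftrightarrow> b \<in> set p"
  using append_butlast_last_id[of p] by (metis Un_iff empty_iff insert_iff list.set set_append)

text \<open>A letter exceeds its predecessor by at most one, so a Catalan word skips no value.\<close>

lemma catalan_word_downward_closed:
  assumes "catalan_word p" "b \<in> set p" "1 \<le> a" "a \<le> b"
  shows "a \<in> set p"
  using assms
proof (induction p arbitrary: b rule: rev_induct)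
  case Nil
  then show ?case by simp
next
  case (snoc c p)
  show ?case
  proof (cases "p = []")
    case True
    then show ?thesis using snoc.prems by (auto simp: catalan_word_def)
  next
    case False
    have p: "catalan_word p" "c \<le> Suc (last p)"
      using snoc.prems False by (auto simp: catalan_word_snoc)
    show ?thesis
    proof (cases "b \<in> set p \<or> a = c")
      case True
      then show ?thesis using snoc.IH[OF p(1) _ snoc.prems(3)] snoc.prems(4) by auto
    next
      case c: False
      then have "a \<le> last p" using snoc.prems p by auto
      then show ?thesis using snoc.IH[OF p(1) last_in_set[OF False] snoc.prems(3)] by simp
    qed
  qed
qed

section \<open>Counting completions of a prefix\<close>

definition completions :: "nat \<Rightarrow> nat \<Rightarrow> nat \<Rightarrow> nat list \<Rightarrow> nat \<Rightarrow> nat list set" where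
  "completions x y z p k = {v. length v = k \<and> p @ v \<in> avoiders x y z}"

lemma avoiders_prefix:
  assumes "p \<noteq> []" "p @ v \<in> avoiders x y z"
  shows "p \<in> avoiders x y z"
  using assms
proof (induction v rule: rev_induct)
  case (snoc a v)
  then show ?case using avoiders_snoc[of "p @ v" a x y z] by simp
qed simp

lemma completions_0: "p \<in> avoiders x y z \<Longrightarrow> completions x y z p 0 = {[]}"
  by (auto simp: completions_def)

lemma completions_Suc:
  assumes "p \<noteq> []"
  shows "completions x y z p (Suc k) =
    (\<Union>a \<in> {a. p @ [a] \<in> avoiders x y z}. (#) a ` completions x y z (p @ [a]) k)"
proof (intro set_eqI iffI)
  fix v assume v: "v \<in> completions x y z p (Suc k)"
  then obtain a u where "v = a # u" by (cases v) (auto simp: completions_def)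
  then show "v \<in> (\<Union>a \<in> {a. p @ [a] \<in> avoiders x y z}. (#) a ` completions x y z (p @ [a]) k)"
    using v avoiders_prefix[of "p @ [a]" u x y z] by (auto simp: completions_def)
qed (auto simp: completions_def)

lemma finite_next_letters: "p \<noteq> [] \<Longrightarrow> finite {a. p @ [a] \<in> avoiders x y z}"
  by (rule finite_subset[of _ "{1..Suc (last p)}"]) (auto simp: avoiders_snoc)

lemma finite_completions: "p \<noteq> [] \<Longrightarrow> finite (completions x y z p k)"
proof (induction k arbitrary: p)
  case 0
  then show ?case by (simp add: completions_def)
next
  case (Suc k)
  then show ?case by (simp add: completions_Suc finite_next_letters)
qed

lemma card_completions_Suc:
  assumes "p \<noteq> []" "{a. p @ [a] \<in> avoiders x y z} = L"
  shows "card (completions x y z p (Suc k)) = (\<Sum>a \<in> L. card (completions x y z (p @ [a]) k))"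
proof -
  have "card (\<Union>a \<in> L. (#) a ` completions x y z (p @ [a]) k) =
      (\<Sum>a \<in> L. card ((#) a ` completions x y z (p @ [a]) k))"
    using assms finite_next_letters[OF assms(1)]
    by (intro card_UN_disjoint) (auto simp: finite_completions)
  then show ?thesis using assms by (simp add: completions_Suc card_image)
qed

lemma catalan_avoiding_count_eq:
  assumes "n \<ge> 1"
  shows "catalan_avoiding_count n x y z = card (completions x y z [1] (n - 1))"
proof -
  have "{w \<in> catalan_words n. \<not> contains_vincular w x y z} = (#) 1 ` completions x y z [1] (n - 1)"
  proof (intro set_eqI iffI)
    fix w assume w: "w \<in> {w \<in> catalan_words n. \<not> contains_vincular w x y z}"
    then have "w = 1 # tl w" by (cases w) (auto simp: catalan_words_def catalan_word_def)
    moreover have "tl w \<in> completions x y z [1] (n - 1)"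
      using w calculation by (auto simp: completions_def avoiders_def catalan_words_def)
    ultimately show "w \<in> (#) 1 ` completions x y z [1] (n - 1)" by blast
  qed (use assms in \<open>auto simp: completions_def avoiders_def catalan_words_def\<close>)
  then show ?thesis by (simp add: catalan_avoiding_count_def card_image)
qed

text \<open>If from some point on only letters up to the last one are permitted, then the words that
  follow are the weakly decreasing ones over \<open>{1..l}\<close>, where \<open>l\<close> is the last letter.\<close>

fun decreasing_count :: "nat \<Rightarrow> nat \<Rightarrow> nat" where
  "decreasing_count l 0 = 1"
| "decreasing_count l (Suc k) = (\<Sum>a = 1..l. decreasing_count a k)"

lemma decreasing_count_pascal:
  "decreasing_count (Suc l) (Suc k) = decreasing_count (Suc l) k + decreasing_count l (Suc k)"
  by simp

lemma card_completions_decreasing: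
  assumes "p \<in> I"
    and avoid: "\<And>p. p \<in> I \<Longrightarrow> p \<in> avoiders x y z"
    and letters: "\<And>p. p \<in> I \<Longrightarrow> {a. p @ [a] \<in> avoiders x y z} = {1..last p}"
    and step: "\<And>p a. p \<in> I \<Longrightarrow> a \<in> {1..last p} \<Longrightarrow> p @ [a] \<in> I"
  shows "card (completions x y z p k) = decreasing_count (last p) k"
  using assms(1)
proof (induction k arbitrary: p)
  case 0
  then show ?case by (simp add: completions_0 avoid)
next
  case (Suc k)
  have "card (completions x y z (p @ [a]) k) = decreasing_count a k" if "a \<in> {1..last p}" for a
    using Suc.IH[OF step[OF Suc.prems that]] by simp
  then show ?case
    using card_completions_Suc[OF avoiders_nonempty[OF avoid[OF Suc.prems]] letters[OF Suc.prems]]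
    by simp
qed

section \<open>The patterns 1-21 and 1-23\<close>

lemma next_letters_1_21:
  assumes p: "p \<in> avoiders 1 2 1"
  shows "{a. p @ [a] \<in> avoiders 1 2 1} = {last p, Suc (last p)}"
proof -
  have ne: "p \<noteq> []" and cat: "catalan_word p"
    using p avoiders_nonempty[OF p] by (auto simp: avoiders_def)
  have last: "last p \<in> set p" using ne by simp
  then have l: "1 \<le> last p" using cat by (simp add: catalan_word_def)
  \<comment> \<open>By downward closure appending a letter below the last one completes an occurrence of 1-21.\<close>
  have "a \<in> set (butlast p)" if "1 \<le> a" "a < last p" for a
    using catalan_word_downward_closed[OF cat last that(1)] that
      in_set_butlast_iff[OF ne, of a] by simp
  then have letters: "p @ [a] \<in> avoiders 1 2 1
      \<longleftrightarrow> 1 \<le> a \<and> a \<le> Suc (last p) \<and> \<not> a < last p" for a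
    unfolding avoiders_snoc[OF ne] order_isomorphic_patterns atLeastAtMost_iff using p by blast
  have "p @ [a] \<in> avoiders 1 2 1 \<longleftrightarrow> a \<in> {last p, Suc (last p)}" for a
    unfolding letters using l by auto
  then show ?thesis by blast
qed

lemma card_completions_1_21:
  "p \<in> avoiders 1 2 1 \<Longrightarrow> card (completions 1 2 1 p k) = 2 ^ k"
proof (induction k arbitrary: p)
  case 0
  then show ?case by (simp add: completions_0)
next
  case (Suc k)
  have "card (completions 1 2 1 (p @ [a]) k) = 2 ^ k" if "a \<in> {last p, Suc (last p)}" for a
    using next_letters_1_21[OF Suc.prems] that by (intro Suc.IH) blast
  then show ?case
    using card_completions_Suc[OF avoiders_nonempty[OF Suc.prems] next_letters_1_21[OF Suc.prems]]
    by simp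
qed

lemma next_letters_1_23:
  assumes p: "p \<in> avoiders 1 2 3" and l: "last p \<in> {1, 2}"
  shows "{a. p @ [a] \<in> avoiders 1 2 3} = {1, 2}"
proof -
  have ne: "p \<noteq> []" and cat: "catalan_word p"
    using p avoiders_nonempty[OF p] by (auto simp: avoiders_def)
  have pos: "1 \<le> b" if "b \<in> set (butlast p)" for b
    using cat in_set_butlastD[OF that] by (simp add: catalan_word_def)
  have "1 \<in> set p" using cat by (metis catalan_word_def hd_in_set)
  then have "1 \<in> set (butlast p)" if "last p = 2"
    using in_set_butlast_iff[OF ne, of 1] that by simp
  moreover have "\<not> b < last p" if "last p = 1" "b \<in> set (butlast p)" for b
    using pos[OF that(2)] that(1) by simp
  moreover have "(1::nat) < 2" by simp
  ultimately have "(\<exists>b \<in> set (butlast p). b < last p) \<longleftrightarrow> last p = 2"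
    using l by (metis insert_iff singletonD)
  then have letters: "p @ [a] \<in> avoiders 1 2 3 \<longleftrightarrow>
      1 \<le> a \<and> a \<le> Suc (last p) \<and> \<not> (last p = 2 \<and> last p < a)" for a
    unfolding avoiders_snoc[OF ne] order_isomorphic_patterns atLeastAtMost_iff using p by blast
  have "p @ [a] \<in> avoiders 1 2 3 \<longleftrightarrow> a \<in> {1, 2}" for a
    unfolding letters using l by auto
  then show ?thesis by blast
qed

lemma card_completions_1_23:
  "p \<in> avoiders 1 2 3 \<Longrightarrow> last p \<in> {1, 2} \<Longrightarrow> card (completions 1 2 3 p k) = 2 ^ k"
proof (induction k arbitrary: p)
  case 0
  then show ?case by (simp add: completions_0)
next
  case (Suc k)
  have "card (completions 1 2 3 (p @ [a]) k) = 2 ^ k" if "a \<in> {1, 2}" for a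
    using next_letters_1_23[OF Suc.prems] that by (intro Suc.IH) auto
  then show ?case
    using card_completions_Suc[OF avoiders_nonempty[OF Suc.prems(1)] next_letters_1_23[OF Suc.prems]]
    by simp
qed

section \<open>The pattern 1-12\<close>

lemma next_letters_1_12:
  assumes p: "p \<in> avoiders 1 1 2"
  shows "{a. p @ [a] \<in> avoiders 1 1 2} =
    (if last p \<in> set (butlast p) then {1..last p} else {1..Suc (last p)})"
  unfolding avoiders_snoc[OF avoiders_nonempty[OF p]] order_isomorphic_patterns using p by auto

text \<open>No value up to the last letter has been skipped, so any letter written after a repeated one
  is a repetition as well, and no further ascent is possible.\<close>

lemma card_completions_1_12_repeated:
  assumes "p \<in> avoiders 1 1 2" "last p \<in> set (butlast p)"
  shows "card (completions 1 1 2 p k) = decreasing_count (last p) k"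
proof (rule card_completions_decreasing[where I = "{p \<in> avoiders 1 1 2. last p \<in> set (butlast p)}"])
  fix p assume "p \<in> {p \<in> avoiders 1 1 2. last p \<in> set (butlast p)}"
  then have p: "p \<in> avoiders 1 1 2" and rep: "last p \<in> set (butlast p)" by simp_all
  show "p \<in> avoiders 1 1 2" by (rule p)
  show L: "{a. p @ [a] \<in> avoiders 1 1 2} = {1..last p}"
    unfolding next_letters_1_12[OF p] using rep by (rule if_P)
  fix a assume a: "a \<in> {1..last p}"
  have "catalan_word p" using p by (simp add: avoiders_def)
  then have "a \<in> set p"
    using a catalan_word_downward_closed[of p "last p" a] avoiders_nonempty[OF p] by simp
  moreover have "p @ [a] \<in> avoiders 1 1 2" using L a by blast
  ultimately show "p @ [a] \<in> {p \<in> avoiders 1 1 2. last p \<in> set (butlast p)}" by simp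
qed (use assms in simp)

text \<open>The number of completions by \<open>k\<close> letters of a 1-12-avoider whose last letter \<open>l\<close> is a strict
  maximum: the next letter is \<open>l + 1\<close>, or it starts a weakly decreasing word over \<open>{1..l}\<close>.\<close>

fun count_1_12 :: "nat \<Rightarrow> nat \<Rightarrow> nat" where
  "count_1_12 l 0 = 1"
| "count_1_12 l (Suc k) = count_1_12 (Suc l) k + decreasing_count l (Suc k)"

lemma count_1_12_pascal:
  "count_1_12 (Suc l) (Suc k) = count_1_12 (Suc l) k + count_1_12 l (Suc k)"
proof (induction k arbitrary: l)
  case (Suc k)
  have "count_1_12 (Suc l) (Suc (Suc k)) =
      count_1_12 (Suc (Suc l)) (Suc k) + decreasing_count (Suc l) (Suc (Suc k))"
    by (rule count_1_12.simps(2))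
  also have "\<dots> = (count_1_12 (Suc (Suc l)) k + count_1_12 (Suc l) (Suc k))
      + (decreasing_count (Suc l) (Suc k) + decreasing_count l (Suc (Suc k)))"
    by (simp only: Suc.IH decreasing_count_pascal)
  also have "\<dots> = count_1_12 (Suc l) (Suc k) + count_1_12 l (Suc (Suc k))"
    by (simp only: count_1_12.simps(2) ac_simps)
  finally show ?case .
qed simp

text \<open>The Pascal rule at \<open>l = 0\<close> doubles the count, since \<open>decreasing_count 0 (Suc k) = 0\<close> makes
  \<open>count_1_12 0 (Suc k)\<close> equal to \<open>count_1_12 1 k\<close>.\<close>

lemma count_1_12_one: "count_1_12 1 k = 2 ^ k"
proof (induction k)
  case (Suc k)
  have "count_1_12 1 (Suc k) = count_1_12 1 k + count_1_12 0 (Suc k)"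
    using count_1_12_pascal[of 0 k] by simp
  also have "count_1_12 0 (Suc k) = count_1_12 1 k" by simp
  finally show ?case using Suc.IH by simp
qed simp

lemma card_completions_1_12_new_max:
  "p \<in> avoiders 1 1 2 \<Longrightarrow> \<forall>b \<in> set (butlast p). b < last p \<Longrightarrow>
    card (completions 1 1 2 p k) = count_1_12 (last p) k"
proof (induction k arbitrary: p)
  case 0
  then show ?case by (simp add: completions_0)
next
  case (Suc k)
  let ?l = "last p"
  have ne: "p \<noteq> []" and cat: "catalan_word p"
    using Suc.prems avoiders_nonempty[OF Suc.prems(1)] by (auto simp: avoiders_def)
  have L: "{a. p @ [a] \<in> avoiders 1 1 2} = {1..Suc ?l}"
    using next_letters_1_12[OF Suc.prems(1)] Suc.prems(2) by auto
  have "card (completions 1 1 2 (p @ [a]) k) = decreasing_count a k" if a: "a \<in> {1..?l}" for a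
  proof -
    have "a \<in> set p" using catalan_word_downward_closed[OF cat last_in_set[OF ne]] a by simp
    moreover have "a \<in> {1..Suc ?l}" using a by simp
    then have "p @ [a] \<in> avoiders 1 1 2" using L by blast
    ultimately show ?thesis using card_completions_1_12_repeated[of "p @ [a]" k] by simp
  qed
  moreover have "card (completions 1 1 2 (p @ [Suc ?l]) k) = count_1_12 (Suc ?l) k"
  proof -
    have "b < Suc ?l" if "b \<in> set p" for b
      using that in_set_butlast_iff[OF ne, of b] Suc.prems(2) by (cases "b = ?l") auto
    moreover have "Suc ?l \<in> {1..Suc ?l}" by simp
    then have "p @ [Suc ?l] \<in> avoiders 1 1 2" using L by blast
    ultimately show ?thesis using Suc.IH[of "p @ [Suc ?l]"] by simp
  qed
  ultimately show ?case using card_completions_Suc[OF ne L] by simp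
qed

section \<open>The pattern 2-12\<close>

lemma set_snoc_new_max: "set p = {1..m} \<Longrightarrow> set (p @ [Suc m]) = {1..Suc m}"
  by (simp add: atLeastAtMostSuc_conv)

text \<open>An ascent from below the maximum hits a value that has occurred, because none is skipped,
  whereas an ascent from the maximum creates a new value.\<close>

lemma next_letters_2_12:
  assumes p: "p \<in> avoiders 2 1 2" and m: "set p = {1..m}"
  shows "{a. p @ [a] \<in> avoiders 2 1 2} = (if last p < m then {1..last p} else {1..Suc m})"
proof -
  have ne: "p \<noteq> []" by (rule avoiders_nonempty[OF p])
  have l: "last p \<le> m" using last_in_set[OF ne] m by simp
  have "Suc (last p) \<in> set (butlast p) \<longleftrightarrow> last p < m"
    using in_set_butlast_iff[OF ne, of "Suc (last p)"] m by (simp add: Suc_le_eq)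
  then have letters: "p @ [a] \<in> avoiders 2 1 2 \<longleftrightarrow>
      1 \<le> a \<and> a \<le> Suc (last p) \<and> \<not> (a = Suc (last p) \<and> last p < m)" for a
    unfolding avoiders_snoc[OF ne] order_isomorphic_patterns atLeastAtMost_iff using p
    by (auto simp: le_Suc_eq)
  show ?thesis unfolding letters using l by auto
qed

lemma card_completions_2_12_below_max:
  assumes "p \<in> avoiders 2 1 2" "set p = {1..m}" "last p < m"
  shows "card (completions 2 1 2 p k) = decreasing_count (last p) k"
proof (rule card_completions_decreasing
    [where I = "{p \<in> avoiders 2 1 2. set p = {1..m} \<and> last p < m}"])
  fix p assume "p \<in> {p \<in> avoiders 2 1 2. set p = {1..m} \<and> last p < m}"
  then have p: "p \<in> avoiders 2 1 2" "set p = {1..m}" "last p < m" by simp_all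
  show "p \<in> avoiders 2 1 2" by (rule p(1))
  show L: "{a. p @ [a] \<in> avoiders 2 1 2} = {1..last p}"
    unfolding next_letters_2_12[OF p(1,2)] using p(3) by (rule if_P)
  fix a assume a: "a \<in> {1..last p}"
  then have "p @ [a] \<in> avoiders 2 1 2" using L by blast
  moreover have "a \<in> set p" using p(2,3) a by simp
  then have "set (p @ [a]) = {1..m}" using p(2) by (simp add: insert_absorb)
  ultimately show "p @ [a] \<in> {p \<in> avoiders 2 1 2. set p = {1..m} \<and> last p < m}"
    using p(3) a by simp
qed (use assms in simp)

text \<open>The number of completions by \<open>k\<close> letters of a 2-12-avoider whose last letter \<open>i + 1\<close> is its
  maximum. The next letter exceeds the maximum, equals it, or starts a weakly decreasing word over
  \<open>{1..i}\<close>.\<close>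

fun count_2_12 :: "nat \<Rightarrow> nat \<Rightarrow> nat" where
  "count_2_12 i 0 = 1"
| "count_2_12 i (Suc k) = count_2_12 (Suc i) k + count_2_12 i k + decreasing_count i (Suc k)"

lemma count_2_12_pascal:
  "count_2_12 (Suc i) (Suc k) = count_2_12 (Suc i) k + count_2_12 i (Suc k)"
proof (induction k arbitrary: i)
  case (Suc k)
  have "count_2_12 (Suc i) (Suc (Suc k)) =
      count_2_12 (Suc (Suc i)) (Suc k) + count_2_12 (Suc i) (Suc k)
      + decreasing_count (Suc i) (Suc (Suc k))"
    by (rule count_2_12.simps(2))
  also have "\<dots> = (count_2_12 (Suc (Suc i)) k + count_2_12 (Suc i) (Suc k))
      + (count_2_12 (Suc i) k + count_2_12 i (Suc k))
      + (decreasing_count (Suc i) (Suc k) + decreasing_count i (Suc (Suc k)))"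
    by (simp only: Suc.IH decreasing_count_pascal)
  also have "\<dots> = count_2_12 (Suc i) (Suc k) + count_2_12 i (Suc (Suc k))"
    by (simp only: count_2_12.simps(2) ac_simps)
  finally show ?case .
qed simp

text \<open>The defining recurrence at \<open>i = 0\<close> and the Pascal rule are the Fibonacci recurrence at odd
  and even indices, so the parameters 0 and 1 have to be treated together.\<close>

lemma count_2_12_fib:
  "count_2_12 0 k = fib (2 * k + 1) \<and> count_2_12 1 k = fib (2 * k + 2)"
proof (induction k)
  case (Suc k)
  have 0: "count_2_12 0 (Suc k) = fib (2 * Suc k + 1)" using Suc.IH by simp
  have "count_2_12 1 (Suc k) = count_2_12 1 k + count_2_12 0 (Suc k)"
    using count_2_12_pascal[of 0 k] by simp
  also have "\<dots> = fib (2 * Suc k + 2)" using Suc.IH 0 by simp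
  finally show ?case using 0 by blast
qed simp

lemma card_completions_2_12_at_max:
  "p \<in> avoiders 2 1 2 \<Longrightarrow> set p = {1..Suc i} \<Longrightarrow> last p = Suc i \<Longrightarrow>
    card (completions 2 1 2 p k) = count_2_12 i k"
proof (induction k arbitrary: p i)
  case 0
  then show ?case by (simp add: completions_0)
next
  case (Suc k)
  have ne: "p \<noteq> []" by (rule avoiders_nonempty[OF Suc.prems(1)])
  have L: "{a. p @ [a] \<in> avoiders 2 1 2} = {1..Suc (Suc i)}"
    using next_letters_2_12[OF Suc.prems(1,2)] Suc.prems(3) by simp
  have A: "p @ [a] \<in> avoiders 2 1 2" if "a \<in> {1..Suc (Suc i)}" for a
    using L that by blast
  have S: "set (p @ [a]) = {1..Suc i}" if "a \<in> {1..Suc i}" for a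
    using Suc.prems(2) that by (simp add: insert_absorb)
  have "card (completions 2 1 2 (p @ [a]) k) = decreasing_count a k" if "a \<in> {1..i}" for a
  proof (subst card_completions_2_12_below_max)
    show "p @ [a] \<in> avoiders 2 1 2" using that by (intro A) simp
    show "set (p @ [a]) = {1..Suc i}" using that by (intro S) simp
  qed (use that in simp_all)
  then have "(\<Sum>a = 1..i. card (completions 2 1 2 (p @ [a]) k)) = decreasing_count i (Suc k)"
    by simp
  moreover have "card (completions 2 1 2 (p @ [Suc i]) k) = count_2_12 i k"
  proof (rule Suc.IH)
    show "p @ [Suc i] \<in> avoiders 2 1 2" by (rule A) simp
    show "set (p @ [Suc i]) = {1..Suc i}" by (rule S) simp
  qed simp
  moreover have "card (completions 2 1 2 (p @ [Suc (Suc i)]) k) = count_2_12 (Suc i) k"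
  proof (rule Suc.IH)
    show "p @ [Suc (Suc i)] \<in> avoiders 2 1 2" by (rule A) simp
    show "set (p @ [Suc (Suc i)]) = {1..Suc (Suc i)}"
      by (rule set_snoc_new_max[OF Suc.prems(2)])
  qed simp
  moreover have "card (completions 2 1 2 p (Suc k)) =
      (\<Sum>a = 1..i. card (completions 2 1 2 (p @ [a]) k)) +
      card (completions 2 1 2 (p @ [Suc i]) k) + card (completions 2 1 2 (p @ [Suc (Suc i)]) k)"
    unfolding card_completions_Suc[OF ne L] by simp
  ultimately show ?case by (simp only: count_2_12.simps(2) ac_simps)
qed

section \<open>The pattern 3-12\<close>

text \<open>The condition on an ascent compares its upper letter with the maximum only, as an earlier
  letter above it exists iff the maximum is above it.\<close>

lemma next_letters_3_12:
  assumes p: "p \<in> avoiders 3 1 2" and m: "set p = {1..m}"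
  shows "{a. p @ [a] \<in> avoiders 3 1 2} =
    (if Suc (last p) < m then {1..last p} else {1..Suc (last p)})"
proof -
  have ne: "p \<noteq> []" by (rule avoiders_nonempty[OF p])
  have "(\<exists>b \<in> set (butlast p). Suc (last p) < b) \<longleftrightarrow> Suc (last p) < m" (is "?L \<longleftrightarrow> ?R")
  proof
    assume ?L
    then show ?R using m by (auto dest!: in_set_butlastD)
  next
    assume ?R
    then have "m \<in> set (butlast p)" using in_set_butlast_iff[OF ne, of m] m by auto
    then show ?L using \<open>?R\<close> by blast
  qed
  then have letters: "p @ [a] \<in> avoiders 3 1 2 \<longleftrightarrow>
      1 \<le> a \<and> a \<le> Suc (last p) \<and> \<not> (a = Suc (last p) \<and> Suc (last p) < m)" for a
    unfolding avoiders_snoc[OF ne] order_isomorphic_patterns atLeastAtMost_iff using p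
    by (auto simp: le_Suc_eq)
  show ?thesis unfolding letters by auto
qed

lemma card_completions_3_12_far_below_max:
  assumes "p \<in> avoiders 3 1 2" "set p = {1..m}" "Suc (last p) < m"
  shows "card (completions 3 1 2 p k) = decreasing_count (last p) k"
proof (rule card_completions_decreasing
    [where I = "{p \<in> avoiders 3 1 2. set p = {1..m} \<and> Suc (last p) < m}"])
  fix p assume "p \<in> {p \<in> avoiders 3 1 2. set p = {1..m} \<and> Suc (last p) < m}"
  then have p: "p \<in> avoiders 3 1 2" "set p = {1..m}" "Suc (last p) < m" by simp_all
  show "p \<in> avoiders 3 1 2" by (rule p(1))
  show L: "{a. p @ [a] \<in> avoiders 3 1 2} = {1..last p}"
    unfolding next_letters_3_12[OF p(1,2)] using p(3) by (rule if_P)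
  fix a assume a: "a \<in> {1..last p}"
  then have "p @ [a] \<in> avoiders 3 1 2" using L by blast
  moreover have "a \<in> set p" using p(2,3) a by simp
  then have "set (p @ [a]) = {1..m}" using p(2) by (simp add: insert_absorb)
  ultimately show "p @ [a] \<in> {p \<in> avoiders 3 1 2. set p = {1..m} \<and> Suc (last p) < m}"
    using p(3) a by simp
qed (use assms in simp)

text \<open>The numbers of completions by \<open>k\<close> letters of a 3-12-avoider with maximum \<open>i + 2\<close> whose last
  letter is the maximum (\<open>count_3_12_top\<close>) or one less (\<open>count_3_12_sub\<close>). The next letter is \<open>i + 3\<close> (only
  from the maximum), \<open>i + 2\<close>, \<open>i + 1\<close>, or it starts a weakly decreasing word over \<open>{1..i}\<close>.\<close>

fun count_3_12_top :: "nat \<Rightarrow> nat \<Rightarrow> nat" and count_3_12_sub :: "nat \<Rightarrow> nat \<Rightarrow> nat" where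
  "count_3_12_top i 0 = 1"
| "count_3_12_top i (Suc k) = count_3_12_top (Suc i) k + count_3_12_top i k
     + count_3_12_sub i k + decreasing_count i (Suc k)"
| "count_3_12_sub i 0 = 1"
| "count_3_12_sub i (Suc k) = count_3_12_top i k + count_3_12_sub i k + decreasing_count i (Suc k)"

lemma count_3_12_pascal:
  "count_3_12_top (Suc i) (Suc k) = count_3_12_top (Suc i) k + count_3_12_top i (Suc k) \<and>
   count_3_12_sub (Suc i) (Suc k) = count_3_12_sub (Suc i) k + count_3_12_sub i (Suc k)"
proof (induction k arbitrary: i)
  case (Suc k)
  have "count_3_12_top (Suc i) (Suc (Suc k)) =
      (count_3_12_top (Suc (Suc i)) k + count_3_12_top (Suc i) (Suc k))
      + (count_3_12_top (Suc i) k + count_3_12_top i (Suc k))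
      + (count_3_12_sub (Suc i) k + count_3_12_sub i (Suc k))
      + (decreasing_count (Suc i) (Suc k) + decreasing_count i (Suc (Suc k)))"
    by (subst count_3_12_top.simps(2)) (simp only: Suc.IH decreasing_count_pascal)
  also have "\<dots> = count_3_12_top (Suc i) (Suc k) + count_3_12_top i (Suc (Suc k))"
    by (simp only: count_3_12_top.simps(2) ac_simps)
  finally have top: "count_3_12_top (Suc i) (Suc (Suc k)) =
      count_3_12_top (Suc i) (Suc k) + count_3_12_top i (Suc (Suc k))" .
  have "count_3_12_sub (Suc i) (Suc (Suc k)) =
      (count_3_12_top (Suc i) k + count_3_12_top i (Suc k))
      + (count_3_12_sub (Suc i) k + count_3_12_sub i (Suc k))
      + (decreasing_count (Suc i) (Suc k) + decreasing_count i (Suc (Suc k)))"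
    by (subst count_3_12_sub.simps(2)) (simp only: Suc.IH decreasing_count_pascal)
  also have "\<dots> = count_3_12_sub (Suc i) (Suc k) + count_3_12_sub i (Suc (Suc k))"
    by (simp only: count_3_12_sub.simps(2) ac_simps)
  finally show ?case using top by blast
qed simp

text \<open>Write \<open>t\<^sub>i\<close> and \<open>s\<^sub>i\<close> for the two counting functions. The Pascal rule adds \<open>t\<^sub>0 (k + 1)\<close> to
  \<open>t\<^sub>1 k\<close> and the recurrence of \<open>s\<^sub>0\<close> adds \<open>t\<^sub>0 k\<close> to \<open>s\<^sub>0 k\<close>. Together with the unchanged summand
  \<open>t\<^sub>0 (k + 1)\<close>, and as \<open>t\<^sub>0 k + t\<^sub>1 k + s\<^sub>0 k = t\<^sub>0 (k + 1)\<close>, this triples the count.\<close>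

lemma count_3_12_top_zero: "count_3_12_top 0 k = 3 ^ k"
proof -
  have "count_3_12_top 0 (Suc k) = 3 * count_3_12_top 0 k" for k
  proof (cases k)
    case (Suc j)
    have "count_3_12_top 0 (Suc (Suc j)) =
        count_3_12_top 1 (Suc j) + count_3_12_top 0 (Suc j) + count_3_12_sub 0 (Suc j)"
      by simp
    moreover have "count_3_12_top 1 (Suc j) = count_3_12_top 1 j + count_3_12_top 0 (Suc j)"
      using count_3_12_pascal[of 0 j] by simp
    moreover have "count_3_12_sub 0 (Suc j) = count_3_12_top 0 j + count_3_12_sub 0 j" by simp
    moreover have "count_3_12_top 0 (Suc j) =
        count_3_12_top 1 j + count_3_12_top 0 j + count_3_12_sub 0 j" by simp
    ultimately show ?thesis unfolding Suc by linarith
  qed simp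
  then show ?thesis by (induction k) simp_all
qed

lemma card_completions_3_12_near_max:
  assumes "p \<in> avoiders 3 1 2" "set p = {1..Suc (Suc i)}"
  shows "last p = Suc (Suc i) \<Longrightarrow> card (completions 3 1 2 p k) = count_3_12_top i k"
    and "last p = Suc i \<Longrightarrow> card (completions 3 1 2 p k) = count_3_12_sub i k"
  using assms
proof (induction k arbitrary: p i)
  case 0
  {
    case 1
    then show ?case by (simp add: completions_0)
  next
    case 2
    then show ?case by (simp add: completions_0)
  }
next
  case (Suc k)
  have low: "(\<Sum>a = 1..i. card (completions 3 1 2 (p @ [a]) k)) = decreasing_count i (Suc k)"
    and sub: "card (completions 3 1 2 (p @ [Suc i]) k) = count_3_12_sub i k"
    and top: "card (completions 3 1 2 (p @ [Suc (Suc i)]) k) = count_3_12_top i k"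
    if p: "p \<in> avoiders 3 1 2" "set p = {1..Suc (Suc i)}" "last p \<in> {Suc i, Suc (Suc i)}"
    for p i
  proof -
    have L: "p @ [a] \<in> avoiders 3 1 2" and S: "set (p @ [a]) = {1..Suc (Suc i)}"
      if "a \<in> {1..Suc (Suc i)}" for a
    proof -
      have "{1..Suc (Suc i)} \<subseteq> {a. p @ [a] \<in> avoiders 3 1 2}"
        unfolding next_letters_3_12[OF p(1,2)] using p(3) by auto
      then show "p @ [a] \<in> avoiders 3 1 2" using that by blast
      show "set (p @ [a]) = {1..Suc (Suc i)}" using p(2) that by (simp add: insert_absorb)
    qed
    have "card (completions 3 1 2 (p @ [a]) k) = decreasing_count a k" if "a \<in> {1..i}" for a
    proof (subst card_completions_3_12_far_below_max)
      show "p @ [a] \<in> avoiders 3 1 2" using that by (intro L) simp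
      show "set (p @ [a]) = {1..Suc (Suc i)}" using that by (intro S) simp
    qed (use that in simp_all)
    then show "(\<Sum>a = 1..i. card (completions 3 1 2 (p @ [a]) k)) = decreasing_count i (Suc k)"
      by simp
    show "card (completions 3 1 2 (p @ [Suc i]) k) = count_3_12_sub i k"
      by (rule Suc.IH(2)[OF _ L S]) simp_all
    show "card (completions 3 1 2 (p @ [Suc (Suc i)]) k) = count_3_12_top i k"
      by (rule Suc.IH(1)[OF _ L S]) simp_all
  qed
  {
    case 1
    have ne: "p \<noteq> []" by (rule avoiders_nonempty[OF 1(2)])
    have L: "{a. p @ [a] \<in> avoiders 3 1 2} = {1..Suc (Suc (Suc i))}"
      using next_letters_3_12[OF 1(2,3)] 1(1) by simp
    have "Suc (Suc (Suc i)) \<in> {1..Suc (Suc (Suc i))}" by simp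
    then have "p @ [Suc (Suc (Suc i))] \<in> avoiders 3 1 2" using L by blast
    then have new: "card (completions 3 1 2 (p @ [Suc (Suc (Suc i))]) k) = count_3_12_top (Suc i) k"
      by (rule Suc.IH(1)[OF _ _ set_snoc_new_max[OF 1(3)], rotated]) simp
    have l: "last p \<in> {Suc i, Suc (Suc i)}" using 1(1) by simp
    have "card (completions 3 1 2 p (Suc k)) =
        (\<Sum>a = 1..i. card (completions 3 1 2 (p @ [a]) k)) +
        card (completions 3 1 2 (p @ [Suc i]) k) + card (completions 3 1 2 (p @ [Suc (Suc i)]) k) +
        card (completions 3 1 2 (p @ [Suc (Suc (Suc i))]) k)"
      unfolding card_completions_Suc[OF ne L] by simp
    then show ?case
      by (simp only: low[OF 1(2,3) l] sub[OF 1(2,3) l] top[OF 1(2,3) l] new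
          count_3_12_top.simps(2) ac_simps)
  next
    case 2
    have ne: "p \<noteq> []" by (rule avoiders_nonempty[OF 2(2)])
    have L: "{a. p @ [a] \<in> avoiders 3 1 2} = {1..Suc (Suc i)}"
      using next_letters_3_12[OF 2(2,3)] 2(1) by simp
    have l: "last p \<in> {Suc i, Suc (Suc i)}" using 2(1) by simp
    have "card (completions 3 1 2 p (Suc k)) =
        (\<Sum>a = 1..i. card (completions 3 1 2 (p @ [a]) k)) +
        card (completions 3 1 2 (p @ [Suc i]) k) + card (completions 3 1 2 (p @ [Suc (Suc i)]) k)"
      unfolding card_completions_Suc[OF ne L] by simp
    then show ?case
      by (simp only: low[OF 2(2,3) l] sub[OF 2(2,3) l] top[OF 2(2,3) l]
          count_3_12_sub.simps(2) ac_simps)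
  }
qed

text \<open>As long as only 1s have been written there is no letter below the maximum; the first 2
  leads to the states counted above, and the sum of the resulting powers of 3 is geometric.\<close>

lemma card_completions_3_12_ones:
  "p \<in> avoiders 3 1 2 \<Longrightarrow> set p = {1} \<Longrightarrow> 2 * card (completions 3 1 2 p k) = 3 ^ k + 1"
proof (induction k arbitrary: p)
  case 0
  then show ?case by (simp add: completions_0)
next
  case (Suc k)
  have ne: "p \<noteq> []" by (rule avoiders_nonempty[OF Suc.prems(1)])
  have l: "last p = 1" using last_in_set[OF ne] Suc.prems(2) by simp
  have two: "{1..Suc 1} = {1, 2 :: nat}" by auto
  have ones: "set p = {1..1}" using Suc.prems(2) by simp
  have "\<not> Suc (last p) < 1" by simp
  then have "{a. p @ [a] \<in> avoiders 3 1 2} = {1..Suc (last p)}"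
    unfolding next_letters_3_12[OF Suc.prems(1) ones] by (rule if_not_P)
  then have L: "{a. p @ [a] \<in> avoiders 3 1 2} = {1, 2}"
    unfolding l two .
  have "2 * card (completions 3 1 2 (p @ [1]) k) = 3 ^ k + 1"
  proof (rule Suc.IH)
    show "p @ [1] \<in> avoiders 3 1 2" using L by blast
    show "set (p @ [1]) = {1}" using Suc.prems(2) by simp
  qed
  moreover have "card (completions 3 1 2 (p @ [2]) k) = 3 ^ k"
    unfolding count_3_12_top_zero[symmetric]
  proof (rule card_completions_3_12_near_max(1))
    show "p @ [2] \<in> avoiders 3 1 2" using L by blast
    have "set (p @ [2]) = {1, 2}" unfolding set_append Suc.prems(2) by auto
    then show "set (p @ [2]) = {1..Suc (Suc 0)}" using two by (simp only: One_nat_def)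
  qed simp
  moreover have "card (completions 3 1 2 p (Suc k)) =
      card (completions 3 1 2 (p @ [1]) k) + card (completions 3 1 2 (p @ [2]) k)"
    unfolding card_completions_Suc[OF ne L] by simp
  ultimately show ?case by simp
qed

section \<open>The five counts\<close>

theorem proposition2p1:
  fixes n :: nat
  assumes "n \<ge> 1"
  shows "catalan_avoiding_count n 1 1 2 = 2 ^ (n - 1)
       \<and> catalan_avoiding_count n 1 2 1 = 2 ^ (n - 1)
       \<and> catalan_avoiding_count n 1 2 3 = 2 ^ (n - 1)
       \<and> catalan_avoiding_count n 2 1 2 = fib (2 * n - 1)
       \<and> real (catalan_avoiding_count n 3 1 2) = (3 ^ (n - 1) + 1) / 2"
proof -
  let ?k = "n - 1"
  have "card (completions 1 1 2 [1] ?k) = 2 ^ ?k"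
    using card_completions_1_12_new_max[OF singleton_in_avoiders, of ?k] count_1_12_one by simp
  moreover have "card (completions 1 2 1 [1] ?k) = 2 ^ ?k"
    by (rule card_completions_1_21[OF singleton_in_avoiders])
  moreover have "card (completions 1 2 3 [1] ?k) = 2 ^ ?k"
    by (rule card_completions_1_23[OF singleton_in_avoiders]) simp
  moreover have "card (completions 2 1 2 [1] ?k) = fib (2 * n - 1)"
  proof -
    have "2 * ?k + 1 = 2 * n - 1" using assms by simp
    then show ?thesis
      using card_completions_2_12_at_max[OF singleton_in_avoiders, of 0 ?k] count_2_12_fib[of ?k]
      by simp
  qed
  moreover have "real (card (completions 3 1 2 [1] ?k)) = (3 ^ ?k + 1) / 2"
  proof -
    have "2 * card (completions 3 1 2 [1] ?k) = 3 ^ ?k + 1"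
      by (rule card_completions_3_12_ones[OF singleton_in_avoiders]) simp
    then have "real (2 * card (completions 3 1 2 [1] ?k)) = real (3 ^ ?k + 1)" by (rule arg_cong)
    then show ?thesis by simp
  qed
  ultimately show ?thesis using catalan_avoiding_count_eq[OF assms] by simp
qed

end
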